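(* Let $b\ge 2$ be an integer and let $n,k$ be nonnegative integers, where $k$ has base-$b$ expansion $k=\sum_{i=0}^{N-1}k_ib^i$ with $N$ digits. The base-$b$ Stirling numbers of the second kind satisfy $$\genfrac\{\}{0pt}{}{n}{k}_{b} = \frac{1}{(k!)_b}\sum_{j=0}^k (-1)^{s_b(k)-s_b(j)}\binom{k}{j}_b \left(\prod_{i=0}^{N-1}j_i\right)^n.$$
   Context: All base-$b$ digits lie in $\{0,\dots,b-1\}$. For $0\le j\le k$, $j=\sum_{i=0}^{N-1}j_ib^i$ is the base-$b$ expansion of $j$ padded with zeros to $N$ digits. $\genfrac\{\}{0pt}{}{n}{m}$ denotes the ordinary Stirling number of the second kind (number of partitions of an $n$-element set into $m$ nonempty subsets), and the base-$b$ Stirling number is $\genfrac\{\}{0pt}{}{n}{k}_{b}:=\prod_{i=0}^{N-1}\genfrac\{\}{0pt}{}{n}{k_i}$. The base-$b$ factorial is $(k!)_b:=\prod_{i=0}^{N-1}k_i!$, the base-$b$ binomial coefficient is $\binom{k}{j}_b:=\prod_{i=0}^{N-1}\binom{k_i}{j_i}$ (with $\binom{k_i}{j_i}=0$ if $j_i>k_i$), and $s_b(m)$ is the sum of the base-$b$ digits of $m$. Convention: $0^0=1$. *)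

theory Defs
  imports Complex_Main "HOL-Combinatorics.Stirling" "HOL-Library.Log_Nat"
begin

definition base_digit :: "nat \<Rightarrow> nat \<Rightarrow> nat \<Rightarrow> nat" where
  "base_digit b m i = m div b ^ i mod b"

(* floorlog b m is the number of base-b digits of m (0 for m = 0). *)
definition digit_sum :: "nat \<Rightarrow> nat \<Rightarrow> nat" where
  "digit_sum b m = (\<Sum>i<floorlog b m. base_digit b m i)"

(* In the next three definitions N is the number of digits used, leading zeros included.
   Leading zeros of k do not affect base_fact and base_choose, but base_Stirling does
   depend on them, since Stirling n 0 = 0 for n > 0. *)

definition base_Stirling :: "nat \<Rightarrow> nat \<Rightarrow> nat \<Rightarrow> nat \<Rightarrow> nat" where
  "base_Stirling b N n k = (\<Prod>i<N. Stirling n (base_digit b k i))"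

definition base_fact :: "nat \<Rightarrow> nat \<Rightarrow> nat \<Rightarrow> nat" where
  "base_fact b N k = (\<Prod>i<N. fact (base_digit b k i))"

definition base_choose :: "nat \<Rightarrow> nat \<Rightarrow> nat \<Rightarrow> nat \<Rightarrow> nat" where
  "base_choose b N k j = (\<Prod>i<N. base_digit b k i choose base_digit b j i)"

lemma base_digit_less: "b \<ge> 2 \<Longrightarrow> base_digit b m i < b"
  by (simp add: base_digit_def)

lemma base_digit_expansion: "(\<Sum>i<N. base_digit b m i * b ^ i) = m mod b ^ N"
proof (induction N)
  case (Suc N)
  have "m mod b ^ Suc N = b ^ N * (m div b ^ N mod b) + m mod b ^ N"
    by (simp only: power_Suc2 mod_mult2_eq)
  with Suc show ?case by (simp add: base_digit_def mult.commute)
qed simp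

lemma base_digit_expansion_iff:
  assumes "b \<ge> 2"
  shows "m = (\<Sum>i<N. base_digit b m i * b ^ i) \<longleftrightarrow> m < b ^ N"
proof -
  have "0 < b ^ N" using assms by simp
  then show ?thesis
    by (metis base_digit_expansion mod_less mod_less_divisor)
qed

lemma base_digit_unique:
  assumes "m = (\<Sum>i<N. d i * b ^ i)" and "\<And>i. i < N \<Longrightarrow> d i < b" and "i < N"
  shows "base_digit b m i = d i"
  using assms
proof (induction N arbitrary: m d i)
  case (Suc N)
  have b: "0 < b" and d0: "d 0 < b" using Suc.prems(2)[of 0] by auto
  have m: "m = d 0 + b * (\<Sum>i<N. d (Suc i) * b ^ i)"
    using Suc.prems(1) by (simp add: sum.lessThan_Suc_shift sum_distrib_left mult_ac del: sum.lessThan_Suc)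
  have quot: "m div b = (\<Sum>i<N. d (Suc i) * b ^ i)"
    using m d0 b by simp
  show ?case
  proof (cases i)
    case 0
    then show ?thesis using m d0 by (simp add: base_digit_def)
  next
    case (Suc i')
    then have "base_digit b (m div b) i' = d (Suc i')"
      using Suc.IH[of "m div b" "\<lambda>i. d (Suc i)" i'] quot Suc.prems by auto
    then show ?thesis using Suc by (simp add: base_digit_def div_mult2_eq)
  qed
qed simp

end

theory Submission
  imports Defs
begin

text \<open>
  Expanding the product over the digit positions of the classical formula
  \<open>m! S(n, m) = (\<Sum>d\<le>m. (-1)^(m-d) (m choose d) d^n)\<close> gives a sum over all digit strings of length
  \<open>N\<close>, i.e. over all \<open>j < b ^ N\<close>. If \<open>j > k\<close>, then some digit of \<open>j\<close> exceeds that of \<open>k\<close>,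
  so the base-\<open>b\<close> binomial coefficient vanishes and the sum may stop at \<open>k\<close>.
\<close>

text \<open>Induction on \<open>n\<close>: multiplying the summand by \<open>j\<close> mirrors the
  recurrence \<open>Stirling (Suc n) (Suc l) = Suc l * Stirling n (Suc l) + Stirling n l\<close>,
  because \<open>j * (m choose j) = m * (m choose j) - m * (l choose j)\<close> for
  \<open>m = Suc l\<close>.\<close>

lemma fact_mult_Stirling:
  "(fact m * of_nat (Stirling n m) :: 'a::{comm_ring_1,semiring_char_0}) =
    (\<Sum>j\<le>m. (-1) ^ (m - j) * of_nat (m choose j) * of_nat j ^ n)"
proof (induction n arbitrary: m)
  case 0
  \<comment> \<open>For \<open>n = 0\<close> the alternating sum is the expansion of
    \<open>(1 - 1) ^ m\<close>, which is 1 for \<open>m = 0\<close> and 0 otherwise, just like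
    \<open>Stirling 0 m\<close>.\<close>
  have "(\<Sum>j\<le>m. (-1) ^ (m - j) * of_nat (m choose j) :: 'a) = (1 + (-1)) ^ m"
    unfolding binomial_ring by (simp add: mult.commute)
  then show ?case by (cases m) (simp_all del: sum.atMost_Suc)
next
  case (Suc n)
  show ?case
  proof (cases m)
    case (Suc l)
    let ?t = "\<lambda>m j. (-1) ^ (m - j) * of_nat (m choose j) * of_nat j ^ n :: 'a"
    have absorb: "(of_nat j * of_nat (m choose j) :: 'a) + of_nat m * of_nat (l choose j)
        = of_nat m * of_nat (m choose j)" if "j \<le> m" for j
    proof -
      have "(m - j) * (m choose j) = m * (l choose j)"
        using binomial_absorb_comp[of m j] Suc by simp
      with that have "j * (m choose j) + m * (l choose j) = m * (m choose j)"
        by (metis add_mult_distrib le_add_diff_inverse)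
      then show ?thesis by (metis of_nat_add of_nat_mult)
    qed
    \<comment> \<open>The minus sign in the absorption identity is cancelled by
      \<open>m - j = Suc (l - j)\<close>, which holds only for \<open>j \<le> l\<close>; hence the
      separate case \<open>j = m\<close>.\<close>
    have split: "(-1) ^ (m - j) * of_nat (m choose j) * of_nat j ^ Suc n
        = of_nat m * ?t m j + of_nat m * (if j \<le> l then ?t l j else 0)" if "j \<le> m" for j
    proof (cases "j = m")
      case True
      then show ?thesis using Suc by simp
    next
      case False
      with that Suc have mj: "m - j = Suc (l - j)" "j \<le> l" by auto
      have "(-1) ^ (m - j) * of_nat (m choose j) * of_nat j ^ Suc n
          = (-1) ^ (m - j) * (of_nat j * of_nat (m choose j)) * (of_nat j ^ n :: 'a)"
        by (simp add: mult_ac)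
      also have "of_nat j * of_nat (m choose j)
          = (of_nat m * of_nat (m choose j) - of_nat m * of_nat (l choose j) :: 'a)"
        unfolding eq_diff_eq by (rule absorb[OF that])
      finally show ?thesis using mj by (simp add: algebra_simps)
    qed
    have "(\<Sum>j\<le>m. (-1) ^ (m - j) * of_nat (m choose j) * of_nat j ^ Suc n)
        = (\<Sum>j\<le>m. of_nat m * ?t m j + of_nat m * (if j \<le> l then ?t l j else 0))"
      by (intro sum.cong refl split) simp
    also have "\<dots> = of_nat m * (\<Sum>j\<le>m. ?t m j) + of_nat m * (\<Sum>j\<le>l. ?t l j)"
      unfolding sum.distrib sum_distrib_left[symmetric] using Suc by simp
    also have "\<dots> = of_nat m * (fact m * of_nat (Stirling n m)) +
        of_nat m * (fact l * of_nat (Stirling n l))"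
      by (simp only: Suc.IH)
    also have "\<dots> = fact m * of_nat (Stirling (Suc n) m)"
      using Suc by (simp add: algebra_simps)
    finally show ?thesis by simp
  qed simp
qed

text \<open>Adding \<open>q * b ^ N\<close> puts the digit \<open>q\<close> at position
  \<open>N\<close> and leaves the lower positions alone. This allows induction on the length of a
  digit string.\<close>

lemma base_digit_add_mult_power:
  assumes "r < b ^ N"
  shows "i < N \<Longrightarrow> base_digit b (r + q * b ^ N) i = base_digit b r i"
    and "q < b \<Longrightarrow> base_digit b (r + q * b ^ N) N = q"
proof -
  assume "i < N"
  then obtain d where N: "N = i + Suc d" using less_imp_Suc_add by fastforce
  show "base_digit b (r + q * b ^ N) i = base_digit b r i"
  proof (cases "b = 0")
    case False
    \<comment> \<open>Since \<open>i < N\<close>, the added term is a multiple of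
      \<open>b ^ Suc i\<close>: the factor \<open>b ^ i\<close> goes under \<open>div\<close>, and
      the remaining factor \<open>b\<close> goes under \<open>mod\<close>.\<close>
    have eq: "r + q * b ^ N = r + (b * (q * b ^ d)) * b ^ i"
      by (simp add: N power_add mult_ac)
    show ?thesis unfolding base_digit_def eq using False by simp
  qed (use assms N in simp)
qed (use assms in \<open>simp add: base_digit_def\<close>)

text \<open>Distributivity: picking one \<open>d\<close> from each factor on the right gives a digit
  string of length \<open>N\<close>, and these strings correspond to the numbers below
  \<open>b ^ N\<close>.\<close>

lemma sum_prod_base_digit:
  fixes f :: "nat \<Rightarrow> nat \<Rightarrow> 'a::comm_semiring_1"
  shows "(\<Sum>j<b ^ N. \<Prod>i<N. f i (base_digit b j i)) = (\<Prod>i<N. \<Sum>d<b. f i d)"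
proof (induction N)
  case (Suc N)
  have shift: "sum g {m..<m + l} = (\<Sum>r<l. g (r + m))" for g :: "nat \<Rightarrow> 'a" and m l
    using sum.shift_bounds_nat_ivl[of g 0 m l] by (simp add: add.commute lessThan_atLeast0)
  \<comment> \<open>The range is cut into \<open>b\<close> blocks of length \<open>b ^ N\<close>,
    one for each leading digit \<open>q\<close>.\<close>
  have "(\<Sum>j<b ^ Suc N. \<Prod>i<Suc N. f i (base_digit b j i))
      = (\<Sum>q<b. \<Sum>j\<in>{q * b ^ N..<q * b ^ N + b ^ N}. \<Prod>i<Suc N. f i (base_digit b j i))"
    by (simp only: power_Suc sum.nat_group)
  also have "\<dots> = (\<Sum>q<b. \<Sum>r<b ^ N. \<Prod>i<Suc N. f i (base_digit b (r + q * b ^ N) i))"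
    by (simp only: shift)
  also have "\<dots> = (\<Sum>q<b. \<Sum>r<b ^ N. (\<Prod>i<N. f i (base_digit b r i)) * f N q)"
    by (simp add: base_digit_add_mult_power)
  also have "\<dots> = (\<Prod>i<Suc N. \<Sum>d<b. f i d)"
    by (simp add: Suc.IH flip: sum_distrib_left sum_distrib_right)
  finally show ?case .
qed simp

text \<open>Padding zeros add nothing, so the digit sums of \<open>j\<close> and \<open>k\<close>
  can be compared over the same \<open>N\<close> positions.\<close>

lemma digit_sum_eq:
  assumes "b \<ge> 2" and "m < b ^ N"
  shows "digit_sum b m = (\<Sum>i<N. base_digit b m i)"
  unfolding digit_sum_def
proof (rule sum.mono_neutral_left)
  show "{..<floorlog b m} \<subseteq> {..<N}"
    using assms floorlog_le_iff[of b m N] by (cases "m = 0") (auto simp: floorlog_def)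
  have "m < b ^ floorlog b m"
    using assms floorlog_bounds[of m b] by (cases "m = 0") (auto simp: floorlog_def)
  moreover have "b ^ floorlog b m \<le> b ^ i" if "floorlog b m \<le> i" for i
    using assms that by (intro power_increasing) auto
  ultimately have "base_digit b m i = 0" if "floorlog b m \<le> i" for i
    using that by (metis base_digit_def div_less mod_0 order_less_le_trans)
  then show "\<forall>i\<in>{..<N} - {..<floorlog b m}. base_digit b m i = 0"
    by simp
qed simp

text \<open>The bound on \<open>m\<close> makes its \<open>N\<close>-digit expansion complete, while
  the \<open>N\<close> lowest digits of \<open>k\<close> give \<open>k mod b ^ N\<close>, which is
  at most \<open>k\<close>.\<close>

lemma le_if_base_digits_le:
  assumes "m < b ^ N" and "\<And>i. i < N \<Longrightarrow> base_digit b m i \<le> base_digit b k i"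
  shows "m \<le> k"
proof -
  have "m = (\<Sum>i<N. base_digit b m i * b ^ i)"
    using assms(1) by (simp add: base_digit_expansion)
  also have "\<dots> \<le> (\<Sum>i<N. base_digit b k i * b ^ i)"
    by (intro sum_mono mult_right_mono assms(2)) auto
  also have "\<dots> \<le> k"
    by (simp add: base_digit_expansion)
  finally show ?thesis .
qed

lemma base_choose_eq_0_iff:
  "base_choose b N k j = 0 \<longleftrightarrow> (\<exists>i<N. base_digit b k i < base_digit b j i)"
  by (auto simp: base_choose_def)

theorem theorem7:
  fixes b N n k :: nat
  assumes "b \<ge> 2"
    and "k = (\<Sum>i<N. base_digit b k i * b ^ i)"
  shows "real (base_Stirling b N n k) =
    1 / real (base_fact b N k) *
      (\<Sum>j=0..k. (-1) powi (int (digit_sum b k) - int (digit_sum b j)) *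
        real (base_choose b N k j) * real (\<Prod>i<N. base_digit b j i) ^ n)"
proof -
  let ?t = "\<lambda>j. (-1) powi (int (digit_sum b k) - int (digit_sum b j)) *
        real (base_choose b N k j) * real (\<Prod>i<N. base_digit b j i) ^ n"
  \<comment> \<open>The factor contributed by digit \<open>d\<close> at position \<open>i\<close>.
    Where the subtraction truncates, the binomial coefficient is 0.\<close>
  define f :: "nat \<Rightarrow> nat \<Rightarrow> real" where
    "f i d = (-1) ^ (base_digit b k i - d) * real (base_digit b k i choose d) * real d ^ n" for i d
  have k: "k < b ^ N"
    using assms base_digit_expansion_iff by blast
  have summand: "?t j = (\<Prod>i<N. f i (base_digit b j i))" if j: "j < b ^ N" for j
  proof (cases "base_choose b N k j = 0")
    case True
    then have "(\<Prod>i<N. f i (base_digit b j i)) = 0"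
      by (auto simp: base_choose_eq_0_iff f_def)
    with True show ?thesis by simp
  next
    case False
    then have le: "base_digit b j i \<le> base_digit b k i" if "i < N" for i
      using that by (meson base_choose_eq_0_iff not_le)
    \<comment> \<open>With all digits of \<open>j\<close> dominated by those of \<open>k\<close>,
      the integer exponent is a sum of natural differences, so the sign splits over the
      positions.\<close>
    then have "int (digit_sum b k) - int (digit_sum b j)
        = int (\<Sum>i<N. base_digit b k i - base_digit b j i)"
      by (simp add: digit_sum_eq[OF assms(1) j] digit_sum_eq[OF assms(1) k] le of_nat_diff sum_subtractf)
    then have "((-1::real) powi (int (digit_sum b k) - int (digit_sum b j)))
        = (\<Prod>i<N. (-1) ^ (base_digit b k i - base_digit b j i))"
      by (simp only: power_int_of_nat power_sum)
    then show ?thesis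
      by (simp add: f_def base_choose_def prod.distrib prod_power_distrib)
  qed
  have digit: "(\<Sum>d<b. f i d) = fact (base_digit b k i) * real (Stirling n (base_digit b k i))" for i
  proof -
    \<comment> \<open>Digits above \<open>base_digit b k i\<close> contribute 0, which cuts the sum
      to the range of the classical formula.\<close>
    have "(\<Sum>d<b. f i d) = (\<Sum>d\<le>base_digit b k i. f i d)"
      using base_digit_less[OF assms(1), of k i]
      by (intro sum.mono_neutral_right) (auto simp: f_def)
    then show ?thesis by (simp add: f_def fact_mult_Stirling)
  qed
  have "(\<Sum>j=0..k. ?t j) = (\<Sum>j<b ^ N. ?t j)"
  proof (rule sum.mono_neutral_left)
    have "base_choose b N k j = 0" if "j < b ^ N" "k < j" for j
      using le_if_base_digits_le[of j b N k] that by (meson base_choose_eq_0_iff not_le)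
    then show "\<forall>j\<in>{..<b ^ N} - {0..k}. ?t j = 0"
      by simp
  qed (use k in auto)
  also have "\<dots> = (\<Prod>i<N. \<Sum>d<b. f i d)"
    using summand by (simp flip: sum_prod_base_digit)
  also have "\<dots> = real (base_fact b N k) * real (base_Stirling b N n k)"
    by (simp add: digit base_fact_def base_Stirling_def prod.distrib)
  finally have "(\<Sum>j=0..k. ?t j) = real (base_fact b N k) * real (base_Stirling b N n k)" .
  moreover have "base_fact b N k \<noteq> 0"
    by (simp add: base_fact_def)
  ultimately show ?thesis by simp
qed

end
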